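(* Let $G_0=\mathbb{R}^3$ with the Lorentz metric $ds_0^2=dx_0^2+2e^{x_1}dx_0\,dx_2+\frac{e^{2x_1}}{2}dx_2^2-dx_1^2$. Let $\gamma(t)=(x_0(t),x_1(t),x_2(t))$, $t\in\mathbb{R}$, be a future-directed timelike geodesic of $(G_0,ds_0^2)$ with $ds_0^2(\gamma',\gamma')=1$, starting at the unit (that is, $\gamma(0)=(0,0,0)$), and with $\varphi_0>1$, where $\varphi_0$ is the constant value of $x_0'+e^{x_1}x_2'$ along $\gamma$. Put $$\alpha_1=\frac{\sqrt2-\sqrt{1-(1/\varphi_0)^2}}{\sqrt2+\sqrt{1-(1/\varphi_0)^2}}.$$ Then $\gamma$ has the following form for some $t_0\in\mathbb{R}$: $$x_0(t)=-\varphi_0(t-t_0)+2\sqrt2\arctan\left(\sqrt{\alpha_1}\tan\left(\tfrac{\sqrt{\varphi_0^2+1}\,(t-t_0)}{2}\right)\right)-\left[\varphi_0t_0+2\sqrt2\arctan\left(\sqrt{\alpha_1}\tan\left(\tfrac{-\sqrt{\varphi_0^2+1}\,t_0}{2}\right)\right)\right],$$ $$x_1(t)=\ln\big((1+\alpha_1)+(1-\alpha_1)\cos\tau\big)\Big|_{\tau=-\sqrt{\varphi_0^2+1}\,t_0}^{\tau=\sqrt{\varphi_0^2+1}\,(t-t_0)},$$ $$x_2(t)=\frac{\beta_1\sin\tau}{(1+\alpha_1)+(1-\alpha_1)\cos\tau}\Big|_{\tau=-\sqrt{\varphi_0^2+1}\,t_0}^{\tau=\sqrt{\varphi_0^2+1}\,(t-t_0)},$$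 $$\beta_1=\frac{\sqrt{2(\varphi_0^2-1)}}{\sqrt{\varphi_0^2+1}}\left[(1+\alpha_1)+(1-\alpha_1)\cos\big(\sqrt{\varphi_0^2+1}\,t_0\big)\right].$$ In the case $x_1'(0)=0$ with $t_0=0$, these become $$x_0(t)=-\varphi_0t+2\sqrt2\arctan\left(\sqrt{\alpha_1}\tan\left(\sqrt{\varphi_0^2+1}\,t/2\right)\right),$$ $$x_1(t)=\ln\left[\left((1+\alpha_1)+(1-\alpha_1)\cos\left(\sqrt{\varphi_0^2+1}\,t\right)\right)/2\right],$$ $$x_2(t)=\frac{2\sqrt{2(\varphi_0^2-1)}}{\sqrt{\varphi_0^2+1}}\left[\frac{\sin(\sqrt{\varphi_0^2+1}\,t)}{(1+\alpha_1)+(1-\alpha_1)\cos(\sqrt{\varphi_0^2+1}\,t)}\right].$$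
   Context: $G_0$ is a Lie group on $\mathbb{R}^3$ with coordinates $(x_0,x_1,x_2)$, unit $(0,0,0)$, and left translations $(x_0',x_1',x_2')\mapsto(x_0'+p,\;x_1'+q,\;x_2'e^{-q}+c)$ by the element $(p,q,c)$; the metric $ds_0^2$ (signature $(+,-,-)$) is left-invariant. Left-invariant vector fields: $e_0=\partial_{x_0}$, $e_1=\partial_{x_1}$, $e_2=e^{-x_1}\partial_{x_2}$; $e_0,\ e_1,\ e_2'=\sqrt2(e_0-e_2)$ is an orthonormal frame. Along a geodesic the $e_0$-component of $\gamma'$ in this orthonormal frame, namely $\varphi_0=x_0'+e^{x_1}x_2'$, is constant; future-directed means $\varphi_0>0$ (for unit-speed timelike geodesics then $\varphi_0\ge1$). Convention: for $\beta>0$, the expression $\arctan(\beta\tan s)$, $s\in\mathbb{R}$, denotes the continuous function of $s$ on $\mathbb{R}$ equal to the principal value on $(-\pi/2,\pi/2)$; i.e. it equals $\arctan(\beta\tan s)+k\pi$ (principal arctangent) for $|s-k\pi|<\pi/2$, and equals $\pi/2+k\pi$ at $s=\pi/2+k\pi$, $k\in\mathbb{Z}$. The notation $F(\tau)|_{\tau=A}^{\tau=B}$ means $F(B)-F(A)$. *)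

theory Defs
  imports "HOL-Analysis.Analysis"
begin

section \<open>Geodesics of a metric on \<open>\<real>\<^sup>n\<close>\<close>

text \<open>
  A (pseudo-Riemannian) metric on the coordinate space is a function \<open>g\<close> taking a base
  point and two tangent vectors at that point.
\<close>

type_synonym 'n metric_tensor = "real ^ 'n \<Rightarrow> real ^ 'n \<Rightarrow> real ^ 'n \<Rightarrow> real"

definition metric_matrix :: "'n::finite metric_tensor \<Rightarrow> real ^ 'n \<Rightarrow> real ^ 'n ^ 'n" where
  "metric_matrix g p = (\<chi> i j. g p (axis i 1) (axis j 1))"

definition partial_deriv :: "'n::finite \<Rightarrow> (real ^ 'n \<Rightarrow> real) \<Rightarrow> real ^ 'n \<Rightarrow> real" where
  "partial_deriv i f p = deriv (\<lambda>s. f (p + s *\<^sub>R axis i 1)) 0"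

text \<open>Christoffel symbols of the second kind; \<open>k\<close> is the upper index.\<close>

definition christoffel :: "'n::finite metric_tensor \<Rightarrow> real ^ 'n \<Rightarrow> 'n \<Rightarrow> 'n \<Rightarrow> 'n \<Rightarrow> real" where
  "christoffel g p k i j = (1 / 2) * (\<Sum>l\<in>UNIV. matrix_inv (metric_matrix g p) $ k $ l *
     (partial_deriv i (\<lambda>q. metric_matrix g q $ j $ l) p
      + partial_deriv j (\<lambda>q. metric_matrix g q $ i $ l) p
      - partial_deriv l (\<lambda>q. metric_matrix g q $ i $ j) p))"

definition velocity :: "(real \<Rightarrow> real ^ 'n::finite) \<Rightarrow> real \<Rightarrow> real ^ 'n" where
  "velocity \<gamma> t = vector_derivative \<gamma> (at t)"

definition geodesic :: "'n::finite metric_tensor \<Rightarrow> (real \<Rightarrow> real ^ 'n) \<Rightarrow> bool" where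
  "geodesic g \<gamma> \<longleftrightarrow> (\<forall>t. \<gamma> differentiable (at t) \<and> velocity \<gamma> differentiable (at t) \<and>
     (\<forall>k. velocity (velocity \<gamma>) t $ k
        + (\<Sum>i\<in>UNIV. \<Sum>j\<in>UNIV. christoffel g (\<gamma> t) k i j * velocity \<gamma> t $ i * velocity \<gamma> t $ j) = 0))"

text \<open>Timelike vectors have positive square: the signature is \<open>(+,-,-)\<close>.\<close>

definition timelike_curve :: "'n::finite metric_tensor \<Rightarrow> (real \<Rightarrow> real ^ 'n) \<Rightarrow> bool" where
  "timelike_curve g \<gamma> \<longleftrightarrow> (\<forall>t. g (\<gamma> t) (velocity \<gamma> t) (velocity \<gamma> t) > 0)"


section \<open>The Lorentz metric \<open>ds\<^sub>0\<^sup>2\<close>\<close>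

text \<open>
  The index type \<open>3\<close> has the elements \<open>0, 1, 2\<close> (and \<open>3 = 0\<close>), so the coordinates
  \<open>x\<^sub>0, x\<^sub>1, x\<^sub>2\<close> of \<open>p\<close> are \<open>p $ 0\<close>, \<open>p $ 1\<close>, \<open>p $ 2\<close>. The metric is the polarization of
  \<open>dx\<^sub>0\<^sup>2 + 2 e\<^bsup>x1\<^esup> dx\<^sub>0 dx\<^sub>2 + (e\<^bsup>2 x1\<^esup> / 2) dx\<^sub>2\<^sup>2 - dx\<^sub>1\<^sup>2\<close>.
\<close>

definition ds0 :: "3 metric_tensor" where
  "ds0 p v w = v $ 0 * w $ 0 + exp (p $ 1) * (v $ 0 * w $ 2 + v $ 2 * w $ 0)
     + exp (2 * p $ 1) / 2 * (v $ 2 * w $ 2) - v $ 1 * w $ 1"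

lemma ds0_quadratic:
  "ds0 p v v = (v $ 0)\<^sup>2 + 2 * exp (p $ 1) * v $ 0 * v $ 2 + exp (2 * p $ 1) / 2 * (v $ 2)\<^sup>2 - (v $ 1)\<^sup>2"
  by (simp add: ds0_def power2_eq_square algebra_simps)

text \<open>
  The component of the tangent vector \<open>v\<close> at \<open>p\<close> along \<open>e\<^sub>0\<close> in the orthonormal frame
  \<open>e\<^sub>0 = \<partial>\<^sub>0\<close>, \<open>e\<^sub>1 = \<partial>\<^sub>1\<close>, \<open>e\<^sub>2' = \<surd>2 (e\<^sub>0 - e\<^sub>2)\<close>, where \<open>e\<^sub>2 = e\<^bsup>-x1\<^esup> \<partial>\<^sub>2\<close>.
\<close>

definition e0_component :: "real ^ 3 \<Rightarrow> real ^ 3 \<Rightarrow> real" where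
  "e0_component p v = v $ 0 + exp (p $ 1) * v $ 2"

definition future_directed :: "(real \<Rightarrow> real ^ 3) \<Rightarrow> bool" where
  "future_directed \<gamma> \<longleftrightarrow> (\<forall>t. e0_component (\<gamma> t) (velocity \<gamma> t) > 0)"

lemma three_idx3: "(3::3) = 0"
  by simp

lemma sum_idx3: "(\<Sum>i\<in>UNIV. f (i::3)) = f 0 + f 1 + (f 2 :: real)"
  unfolding sum_3 three_idx3 by (simp only: add_ac)

lemma all_idx3: "(\<forall>i::3. P i) \<longleftrightarrow> P 0 \<and> P 1 \<and> P 2"
  unfolding forall_3 three_idx3 by blast

lemma e0_component_frame:
  assumes "e0 = axis 0 1" "e1 = axis 1 1" "e2 = exp (- p $ 1) *\<^sub>R axis 2 1" "e2' = sqrt 2 *\<^sub>R (e0 - e2)"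
  shows "e0_component p (a *\<^sub>R e0 + b *\<^sub>R e1 + c *\<^sub>R e2') = a"
proof -
  have "exp (p $ 1) * exp (- p $ 1) = 1"
    by (simp add: mult_exp_exp)
  then show ?thesis
    unfolding assms by (simp add: e0_component_def axis_def)
qed

lemma metric_matrix_ds0:
  "metric_matrix ds0 p = (\<chi> i j. if i = 0 \<and> j = 0 then 1 else if i = 1 \<and> j = 1 then - 1
     else if i = 2 \<and> j = 2 then exp (2 * p $ 1) / 2
     else if i = 0 \<and> j = 2 \<or> i = 2 \<and> j = 0 then exp (p $ 1) else 0)"
  unfolding vec_eq_iff all_idx3
  by (simp add: metric_matrix_def ds0_def axis_def)

lemma matrix_inv_ds0:
  "matrix_inv (metric_matrix ds0 p) = (\<chi> i j. if i = 0 \<and> j = 0 then - 1 else if i = 1 \<and> j = 1 then - 1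
     else if i = 2 \<and> j = 2 then - 2 * exp (- 2 * p $ 1)
     else if i = 0 \<and> j = 2 \<or> i = 2 \<and> j = 0 then 2 * exp (- p $ 1) else 0)" (is "_ = ?B")
proof -
  have e: "exp (p $ 1 * 2) = exp (p $ 1) * exp (p $ 1)"
    by (simp add: mult_exp_exp)
  have inv: "metric_matrix ds0 p ** ?B = mat 1" "?B ** metric_matrix ds0 p = mat 1"
    unfolding vec_eq_iff all_idx3
    by (simp_all add: metric_matrix_ds0 matrix_matrix_mult_def mat_def sum_idx3 exp_minus field_simps e)
  have "B = ?B" if "B ** metric_matrix ds0 p = mat 1" for B
  proof -
    have "B ** (metric_matrix ds0 p ** ?B) = ?B"
      by (simp only: matrix_mul_assoc that matrix_mul_lid)
    then show ?thesis
      by (simp only: inv matrix_mul_rid)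
  qed
  then show ?thesis
    unfolding matrix_inv_def by (intro some_equality conjI inv) blast
qed

lemma partial_deriv_ds0:
  "partial_deriv m (\<lambda>q. metric_matrix ds0 q $ i $ j) p =
    (if m = 1 then (if i = 2 \<and> j = 2 then exp (2 * p $ 1)
       else if i = 0 \<and> j = 2 \<or> i = 2 \<and> j = 0 then exp (p $ 1) else 0) else 0)"
proof -
  have 1: "deriv (\<lambda>s. exp (p $ 1 + s)) 0 = exp (p $ 1)"
    by (rule DERIV_imp_deriv) (auto intro!: derivative_eq_intros)
  have 2: "deriv (\<lambda>s. exp (2 * p $ 1 + 2 * s) / 2) 0 = exp (2 * p $ 1)"
    by (rule DERIV_imp_deriv) (auto intro!: derivative_eq_intros)
  have "\<forall>m i j. partial_deriv m (\<lambda>q. metric_matrix ds0 q $ i $ j) p =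
    (if m = 1 then (if i = 2 \<and> j = 2 then exp (2 * p $ 1)
       else if i = 0 \<and> j = 2 \<or> i = 2 \<and> j = 0 then exp (p $ 1) else 0) else 0)"
    unfolding all_idx3 by (simp add: partial_deriv_def metric_matrix_ds0 axis_def 1 2)
  then show ?thesis by blast
qed

lemma christoffel_ds0:
  "christoffel ds0 p k i j =
    (if k = 0 \<and> (i = 0 \<and> j = 1 \<or> i = 1 \<and> j = 0) then 1
     else if k = 0 \<and> (i = 1 \<and> j = 2 \<or> i = 2 \<and> j = 1) then exp (p $ 1) / 2
     else if k = 1 \<and> (i = 0 \<and> j = 2 \<or> i = 2 \<and> j = 0) then exp (p $ 1) / 2
     else if k = 1 \<and> i = 2 \<and> j = 2 then exp (2 * p $ 1) / 2
     else if k = 2 \<and> (i = 0 \<and> j = 1 \<or> i = 1 \<and> j = 0) then - exp (- p $ 1)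
     else 0)"
proof -
  define E where "E = exp (p $ 1)"
  have E: "E \<noteq> 0" "exp (p $ 1) = E" "exp (2 * p $ 1) = E * E" "exp (- p $ 1) = 1 / E"
    "exp (- (2 * p $ 1)) = 1 / (E * E)"
    by (simp_all add: E_def exp_minus mult_exp_exp inverse_eq_divide)
  have "\<forall>k i j. christoffel ds0 p k i j =
    (if k = 0 \<and> (i = 0 \<and> j = 1 \<or> i = 1 \<and> j = 0) then 1
     else if k = 0 \<and> (i = 1 \<and> j = 2 \<or> i = 2 \<and> j = 1) then exp (p $ 1) / 2
     else if k = 1 \<and> (i = 0 \<and> j = 2 \<or> i = 2 \<and> j = 0) then exp (p $ 1) / 2
     else if k = 1 \<and> i = 2 \<and> j = 2 then exp (2 * p $ 1) / 2
     else if k = 2 \<and> (i = 0 \<and> j = 1 \<or> i = 1 \<and> j = 0) then - exp (- p $ 1)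
     else 0)"
    unfolding all_idx3
    by (simp add: christoffel_def sum_idx3 matrix_inv_ds0 partial_deriv_ds0 E)
  then show ?thesis by blast
qed

lemma geodesic_ds0_equations:
  assumes "geodesic ds0 \<gamma>"
  defines "v \<equiv> velocity \<gamma>"
  shows "velocity v t $ 0 = - 2 * v t $ 0 * v t $ 1 - exp (\<gamma> t $ 1) * v t $ 1 * v t $ 2"
    and "velocity v t $ 1 = - exp (\<gamma> t $ 1) * v t $ 0 * v t $ 2 - exp (2 * \<gamma> t $ 1) / 2 * (v t $ 2)\<^sup>2"
    and "velocity v t $ 2 = 2 * exp (- \<gamma> t $ 1) * v t $ 0 * v t $ 1"
proof -
  have *: "velocity v t $ k + (\<Sum>i\<in>UNIV. \<Sum>j\<in>UNIV. christoffel ds0 (\<gamma> t) k i j * v t $ i * v t $ j) = 0" for k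
    using assms unfolding geodesic_def by blast
  show "velocity v t $ 0 = - 2 * v t $ 0 * v t $ 1 - exp (\<gamma> t $ 1) * v t $ 1 * v t $ 2"
    using *[of 0] by (simp add: christoffel_ds0 sum_idx3 algebra_simps)
  show "velocity v t $ 1 = - exp (\<gamma> t $ 1) * v t $ 0 * v t $ 2 - exp (2 * \<gamma> t $ 1) / 2 * (v t $ 2)\<^sup>2"
    using *[of 1] by (simp add: christoffel_ds0 sum_idx3 algebra_simps power2_eq_square)
  show "velocity v t $ 2 = 2 * exp (- \<gamma> t $ 1) * v t $ 0 * v t $ 1"
    using *[of 2] by (simp add: christoffel_ds0 sum_idx3 algebra_simps)
qed

lemma geodesic_e0_component_constant:
  assumes "geodesic ds0 \<gamma>"
  shows "\<exists>c. \<forall>t. e0_component (\<gamma> t) (velocity \<gamma> t) = c"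
proof -
  define v where "v = velocity \<gamma>"
  have d1: "(\<gamma> has_vector_derivative v t) (at t)" and d2: "(v has_vector_derivative velocity v t) (at t)" for t
    using assms by (auto simp: geodesic_def v_def velocity_def[abs_def] vector_derivative_works)
  have c1: "((\<lambda>t. \<gamma> t $ k) has_real_derivative v t $ k) (at t)"
   and c2: "((\<lambda>t. v t $ k) has_real_derivative velocity v t $ k) (at t)" for k t
    using bounded_linear.has_vector_derivative[OF bounded_linear_vec_nth d1]
      bounded_linear.has_vector_derivative[OF bounded_linear_vec_nth d2]
    by (auto simp: has_real_derivative_iff_has_vector_derivative)
  have "((\<lambda>t. v t $ 0 + exp (\<gamma> t $ 1) * v t $ 2) has_real_derivative 0) (at t)" for t
    using DERIV_add[OF c2[of 0] DERIV_mult[OF DERIV_fun_exp[OF c1[of 1]] c2[of 2]], of t]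
    by (simp add: geodesic_ds0_equations[OF assms, folded v_def] exp_minus field_simps)
  then have "v t $ 0 + exp (\<gamma> t $ 1) * v t $ 2 = v 0 $ 0 + exp (\<gamma> 0 $ 1) * v 0 $ 2" for t
    by (intro DERIV_isconst_all) blast
  then show ?thesis
    by (auto simp: e0_component_def v_def)
qed


section \<open>The explicit form of the geodesics\<close>

text \<open>
  The continuous branch on \<open>\<real>\<close> of \<open>arctan (\<beta> tan s)\<close>, for \<open>\<beta> > 0\<close>. At the poles
  \<open>s = \<pi>/2 + k\<pi>\<close> of \<open>tan\<close> its value is \<open>s\<close>.
\<close>

definition arctan_tan :: "real \<Rightarrow> real \<Rightarrow> real" where
  "arctan_tan \<beta> s = (if \<exists>k::int. s = pi / 2 + of_int k * pi then s
     else arctan (\<beta> * tan s) + of_int \<lfloor>s / pi + 1 / 2\<rfloor> * pi)"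

lemma arctan_tan_pole: "arctan_tan \<beta> (pi / 2 + of_int k * pi) = pi / 2 + of_int k * pi"
  by (auto simp: arctan_tan_def)

lemma arctan_tan_branch:
  assumes "\<bar>s - of_int k * pi\<bar> < pi / 2"
  shows "arctan_tan \<beta> s = arctan (\<beta> * tan s) + of_int k * pi"
proof -
  have lt: "of_int k - 1 / 2 < s / pi" "s / pi < of_int k + 1 / 2"
  proof -
    have "- (pi / 2) < s - of_int k * pi" "s - of_int k * pi < pi / 2"
      using assms by linarith+
    then show "of_int k - 1 / 2 < s / pi" "s / pi < of_int k + 1 / 2"
      by (simp_all add: field_simps)
  qed
  have "\<lfloor>s / pi + 1 / 2\<rfloor> = k"
    using lt by (intro floor_unique) auto
  moreover have False if "s = pi / 2 + of_int m * pi" for m :: int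
  proof -
    have "s / pi = of_int m + 1 / 2"
      using that by (simp add: field_simps)
    then have "real_of_int (k - 1) < of_int m" "real_of_int m < of_int k"
      using lt by auto
    then show False
      unfolding of_int_less_iff by linarith
  qed
  ultimately show ?thesis
    by (auto simp: arctan_tan_def)
qed

definition alpha1 :: "real \<Rightarrow> real" where
  "alpha1 \<phi> = (sqrt 2 - sqrt (1 - (1 / \<phi>)\<^sup>2)) / (sqrt 2 + sqrt (1 - (1 / \<phi>)\<^sup>2))"

definition beta1 :: "real \<Rightarrow> real \<Rightarrow> real" where
  "beta1 \<phi> t0 = sqrt (2 * (\<phi>\<^sup>2 - 1)) / sqrt (\<phi>\<^sup>2 + 1) *
     ((1 + alpha1 \<phi>) + (1 - alpha1 \<phi>) * cos (sqrt (\<phi>\<^sup>2 + 1) * t0))"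

text \<open>The notation \<open>F(\<tau>)|\<^bsub>\<tau>=a\<^esub>\<^bsup>\<tau>=b\<^esup>\<close>.\<close>

definition eval_between :: "(real \<Rightarrow> real) \<Rightarrow> real \<Rightarrow> real \<Rightarrow> real" where
  "eval_between F a b = F b - F a"

definition has_geodesic_form :: "real \<Rightarrow> real \<Rightarrow> (real \<Rightarrow> real ^ 3) \<Rightarrow> bool" where
  "has_geodesic_form \<phi> t0 \<gamma> \<longleftrightarrow> (\<forall>t.
     \<gamma> t $ 0 = - \<phi> * (t - t0)
        + 2 * sqrt 2 * arctan_tan (sqrt (alpha1 \<phi>)) (sqrt (\<phi>\<^sup>2 + 1) * (t - t0) / 2)
        - (\<phi> * t0 + 2 * sqrt 2 * arctan_tan (sqrt (alpha1 \<phi>)) (- sqrt (\<phi>\<^sup>2 + 1) * t0 / 2)) \<and>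
     \<gamma> t $ 1 = eval_between (\<lambda>\<tau>. ln ((1 + alpha1 \<phi>) + (1 - alpha1 \<phi>) * cos \<tau>))
        (- sqrt (\<phi>\<^sup>2 + 1) * t0) (sqrt (\<phi>\<^sup>2 + 1) * (t - t0)) \<and>
     \<gamma> t $ 2 = eval_between (\<lambda>\<tau>. beta1 \<phi> t0 * sin \<tau> / ((1 + alpha1 \<phi>) + (1 - alpha1 \<phi>) * cos \<tau>))
        (- sqrt (\<phi>\<^sup>2 + 1) * t0) (sqrt (\<phi>\<^sup>2 + 1) * (t - t0)))"

end

theory Submission
  imports Defs
begin

text \<open>
  With \<open>u = e\<^bsup>x1\<^esup> x\<^sub>2'\<close>, the geodesic equations and the unit speed condition give
  \<open>x\<^sub>1'\<^sup>2 + u\<^sup>2 / 2 = \<phi>\<^sub>0\<^sup>2 - 1\<close>, and \<open>x\<^sub>0' + \<phi>\<^sub>0 = 2 \<phi>\<^sub>0 - u > 0\<close> is a constant multiple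
  of \<open>e\<^bsup>-x1\<^esup>\<close>. The reciprocal \<open>y = 1 / (x\<^sub>0' + \<phi>\<^sub>0)\<close> satisfies
  \<open>y'' = \<phi>\<^sub>0 - (\<phi>\<^sub>0\<^sup>2 + 1) y\<close>, so it is a shifted cosine, whose amplitude is
  fixed by the energy relation. Then \<open>x\<^sub>1\<close> is \<open>ln (y / y 0)\<close>, and the other two
  coordinates are found by integrating \<open>x\<^sub>0' = 1 / y - \<phi>\<^sub>0\<close> and
  \<open>x\<^sub>2' = y 0 (2 \<phi>\<^sub>0 y - 1) / y\<^sup>2\<close>.
\<close>

section \<open>A smooth formula for the continuous branch, and its derivative\<close>

text \<open>By the subtraction formula, the tangent of \<open>arctan (\<beta> * tan r) - r\<close>
  is a fraction in sin and cos whose denominator is a positive combination of squares. Unlike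
  \<open>tan r\<close>, this fraction also makes sense at the poles of tan.\<close>

lemma arctan_scaled_tan:
  assumes "\<beta> > 0" "\<bar>r\<bar> < pi / 2"
  shows "arctan (\<beta> * tan r) = r + arctan ((\<beta> - 1) * sin r * cos r / ((cos r)\<^sup>2 + \<beta> * (sin r)\<^sup>2))"
proof -
  define a where "a = arctan (\<beta> * tan r)"
  have r: "- (pi / 2) < r" "r < pi / 2"
    using assms by linarith+
  have cr: "cos r > 0"
    using r by (intro cos_gt_zero_pi) auto
  have a: "- (pi / 2) < a" "a < pi / 2" "tan a = \<beta> * tan r"
    unfolding a_def by (rule arctan_lbound, rule arctan_ubound, rule tan_arctan)
  have ca: "cos a > 0"
    using a by (intro cos_gt_zero_pi) auto
  have pos: "1 + tan a * tan r > 0"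
    using assms(1) unfolding a(3) by (simp add: add_pos_nonneg mult.assoc)
  have "cos (a - r) = cos a * cos r * (1 + tan a * tan r)"
    using ca cr by (simp add: cos_diff tan_def field_simps)
  then have c: "cos (a - r) > 0"
    using ca cr pos by simp
  \<comment> \<open>Since \<open>a\<close> and \<open>r\<close> have the same sign and both lie
    between -pi/2 and pi/2, so does their difference; hence \<open>arctan_unique\<close> recovers it
    with no added multiple of pi.\<close>
  have range: "- (pi / 2) < a - r" "a - r < pi / 2"
  proof -
    consider "r = 0" | "r > 0" | "r < 0" by linarith
    then have "- (pi / 2) < a - r \<and> a - r < pi / 2"
    proof cases
      case 1
      then show ?thesis using a by simp
    next
      case 2
      then have "a > 0"
        unfolding a_def using assms(1) r tan_gt_zero[of r] by (simp add: zero_less_arctan_iff)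
      then show ?thesis using 2 a r by linarith
    next
      case 3
      then have "a < 0"
        unfolding a_def using assms(1) r tan_less_zero[of r]
        by (simp add: arctan_less_zero_iff mult_pos_neg)
      then show ?thesis using 3 a r by linarith
    qed
    then show "- (pi / 2) < a - r" "a - r < pi / 2" by auto
  qed
  have N: "(cos r)\<^sup>2 + \<beta> * (sin r)\<^sup>2 > 0"
    using assms(1) cr by (intro add_pos_nonneg) auto
  have "tan (a - r) = (tan a - tan r) / (1 + tan a * tan r)"
    using ca cr c by (intro tan_diff) auto
  also have "\<dots> = (\<beta> - 1) * sin r * cos r / ((cos r)\<^sup>2 + \<beta> * (sin r)\<^sup>2)"
  proof -
    have 1: "tan a - tan r = (\<beta> - 1) * sin r * cos r / (cos r)\<^sup>2"
      using cr unfolding a(3) by (simp add: tan_def field_simps power2_eq_square)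
    have 2: "1 + tan a * tan r = ((cos r)\<^sup>2 + \<beta> * (sin r)\<^sup>2) / (cos r)\<^sup>2"
      using cr unfolding a(3) by (simp add: tan_def field_simps power2_eq_square)
    show ?thesis
      unfolding 1 2 using cr by simp
  qed
  finally show ?thesis
    using arctan_unique[OF range] unfolding a_def by simp
qed

text \<open>The correction term is pi-periodic and vanishes where \<open>cos s = 0\<close>, so it is
  the same on every branch and gives the prescribed value at the poles. One formula without cases
  makes \<open>arctan_tan\<close> differentiable everywhere.\<close>

lemma arctan_tan_eq:
  assumes "\<beta> > 0"
  shows "arctan_tan \<beta> s = s + arctan ((\<beta> - 1) * sin s * cos s / ((cos s)\<^sup>2 + \<beta> * (sin s)\<^sup>2))"
proof (cases "\<exists>k::int. s = pi / 2 + of_int k * pi")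
  case True
  then obtain k :: int where k: "s = pi / 2 + of_int k * pi" by blast
  have "cos s = 0"
    unfolding k by (simp add: cos_add mult.commute)
  then show ?thesis
    by (simp add: k arctan_tan_pole)
next
  case False
  define k where "k = \<lfloor>s / pi + 1 / 2\<rfloor>"
  define r where "r = s - of_int k * pi"
  have "of_int k \<le> s / pi + 1 / 2" "s / pi + 1 / 2 < of_int k + 1"
    unfolding k_def by linarith+
  then have "of_int k * pi \<le> s + pi / 2" "s + pi / 2 < of_int k * pi + pi"
    by (simp_all add: field_simps)
  \<comment> \<open>The choice of \<open>k\<close> by the floor still admits the left endpoint
    \<open>r = - pi / 2\<close>, which is a pole and so is excluded in this case.\<close>
  moreover have "s \<noteq> pi / 2 + of_int (k - 1) * pi"
    using False by blast
  ultimately have "- (pi / 2) < r" "r < pi / 2"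
    by (auto simp: r_def algebra_simps)
  then have r: "\<bar>r\<bar> < pi / 2"
    by simp
  have s: "s = r + of_int k * pi"
    by (simp add: r_def)
  have sin0: "sin (of_int k * pi) = 0"
    by (simp add: mult.commute)
  have cos1: "cos (of_int k * pi) * cos (of_int k * pi) = 1"
    using sin_cos_squared_add[of "of_int k * pi"] sin0 by (simp add: power2_eq_square)
  have red: "sin s * cos s = sin r * cos r" "(cos s)\<^sup>2 = (cos r)\<^sup>2" "(sin s)\<^sup>2 = (sin r)\<^sup>2"
    using cos1 by (simp_all add: s sin_add cos_add sin0 power2_eq_square algebra_simps)
  have tan: "tan s = tan r"
    using cos1 by (auto simp: s tan_def sin_add cos_add sin0)
  have "arctan_tan \<beta> s = arctan (\<beta> * tan r) + of_int k * pi"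
    using arctan_tan_branch[of s k \<beta>] r by (simp add: r_def[symmetric] tan)
  then show ?thesis
    unfolding arctan_scaled_tan[OF assms r] mult.assoc red by (simp add: s)
qed

lemma DERIV_arctan_tan:
  assumes "\<beta> > 0"
  shows "(arctan_tan \<beta> has_real_derivative \<beta> / ((cos s)\<^sup>2 + \<beta>\<^sup>2 * (sin s)\<^sup>2)) (at s)"
proof -
  define c d where cd: "c = cos s" "d = sin s"
  have one: "c\<^sup>2 + d\<^sup>2 = 1"
    by (simp add: cd)
  \<comment> \<open>As complex numbers, N + i M = (c + i \<beta> d)(c - i d). The second factor has
    modulus 1, so \<open>N^2 + M^2\<close> is \<open>K\<close>, the squared modulus of the first.
    \<open>M'\<close> and \<open>N'\<close> are the derivatives of \<open>M\<close> and
    \<open>N\<close> in \<open>s\<close>.\<close>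
  define N where "N = c\<^sup>2 + \<beta> * d\<^sup>2"
  define M where "M = (\<beta> - 1) * d * c"
  define K where "K = c\<^sup>2 + \<beta>\<^sup>2 * d\<^sup>2"
  define M' where "M' = (\<beta> - 1) * (c\<^sup>2 - d\<^sup>2)"
  define N' where "N' = 2 * M"
  have cd0: "c \<noteq> 0 \<or> d \<noteq> 0"
    using one by auto
  have N: "N > 0"
    unfolding N_def using assms cd0
    by (cases "c = 0") (auto intro: add_pos_nonneg)
  have K: "K > 0"
    unfolding K_def using assms cd0
    by (cases "c = 0") (auto intro: add_pos_nonneg)
  have sum: "N\<^sup>2 + M\<^sup>2 = K"
  proof -
    have "N\<^sup>2 + M\<^sup>2 = (c\<^sup>2 + d\<^sup>2) * K"
      unfolding N_def M_def K_def by algebra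
    then show ?thesis using one by simp
  qed
  have num: "K + (M' * N - M * N') = \<beta>"
  proof -
    have "N\<^sup>2 + M\<^sup>2 + (M' * N - M * N') = \<beta> * (c\<^sup>2 + d\<^sup>2)\<^sup>2"
      unfolding N_def M_def M'_def N'_def by algebra
    then show ?thesis using one sum by simp
  qed
  have "((\<lambda>s. s + arctan ((\<beta> - 1) * sin s * cos s / ((cos s)\<^sup>2 + \<beta> * (sin s)\<^sup>2)))
      has_real_derivative 1 + (M' * N - M * N') / (N * N) * inverse (1 + (M / N)\<^sup>2)) (at s)"
    using N
    by (auto intro!: derivative_eq_intros
        simp: cd M'_def N'_def N_def M_def power2_eq_square algebra_simps)
  also have "1 + (M' * N - M * N') / (N * N) * inverse (1 + (M / N)\<^sup>2) = \<beta> / K"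
  proof -
    have "1 + (M / N)\<^sup>2 = K / N\<^sup>2"
      using N by (simp add: sum[symmetric] field_simps)
    then have "1 + (M' * N - M * N') / (N * N) * inverse (1 + (M / N)\<^sup>2)
        = (K + (M' * N - M * N')) / K"
      using N K by (simp add: field_simps power2_eq_square)
    then show ?thesis
      by (simp only: num)
  qed
  finally show ?thesis
    by (simp add: arctan_tan_eq[OF assms, abs_def] K_def cd)
qed

section \<open>Uniqueness of antiderivatives and of oscillator solutions\<close>

lemma DERIV_eq_imp_eq:
  fixes f g :: "real \<Rightarrow> real"
  assumes "\<And>t. (f has_real_derivative h t) (at t)" "\<And>t. (g has_real_derivative h t) (at t)"
    and "f a = g a"
  shows "f t = g t"
proof -
  have "((\<lambda>t. f t - g t) has_real_derivative 0) (at t)" for t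
    using DERIV_diff[OF assms(1)[of t] assms(2)[of t]] by simp
  then have "f t - g t = f a - g a"
    by (intro DERIV_isconst_all) blast
  then show ?thesis using assms(3) by simp
qed

text \<open>The energy hypothesis puts \<open>(f 0 / A, g 0 / (\<omega> * A))\<close> on the unit
  circle, and its angle gives the phase. The difference from the cosine with this phase is again a
  solution, with zero initial data; its conserved energy is zero, so it vanishes.\<close>

lemma harmonic_oscillator:
  fixes f g :: "real \<Rightarrow> real"
  assumes f: "\<And>t. (f has_real_derivative g t) (at t)"
    and g: "\<And>t. (g has_real_derivative - (\<omega>\<^sup>2 * f t)) (at t)"
    and energy: "(\<omega> * f 0)\<^sup>2 + (g 0)\<^sup>2 = (\<omega> * A)\<^sup>2"
    and "\<omega> > 0" "A > 0"
  shows "\<exists>t0. \<forall>t. f t = A * cos (\<omega> * (t - t0))"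
proof -
  have "(f 0 / A)\<^sup>2 + (g 0 / (\<omega> * A))\<^sup>2 = ((\<omega> * f 0)\<^sup>2 + (g 0)\<^sup>2) / (\<omega> * A)\<^sup>2"
    using assms(4,5) by (simp add: power_divide power_mult_distrib add_divide_distrib)
  also have "\<dots> = 1"
    using assms(4,5) by (simp add: energy)
  finally obtain \<theta> where \<theta>: "f 0 / A = cos \<theta>" "g 0 / (\<omega> * A) = sin \<theta>"
    using sincos_total_2pi by metis
  define t0 where "t0 = \<theta> / \<omega>"
  have wt0: "\<omega> * t0 = \<theta>"
    using assms(4) by (simp add: t0_def)
  define h where "h = (\<lambda>t. f t - A * cos (\<omega> * (t - t0)))"
  define k where "k = (\<lambda>t. g t + \<omega> * A * sin (\<omega> * (t - t0)))"
  have h: "(h has_real_derivative k t) (at t)" for t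
    unfolding h_def k_def by (auto intro!: derivative_eq_intros f)
  have k: "(k has_real_derivative - (\<omega>\<^sup>2 * h t)) (at t)" for t
    unfolding h_def k_def
    by (auto intro!: derivative_eq_intros g simp: algebra_simps power2_eq_square)
  have init: "h 0 = 0" "k 0 = 0"
    using \<theta> assms(4,5) by (simp_all add: h_def k_def wt0 field_simps)
  have "((\<lambda>t. (k t)\<^sup>2 + (\<omega> * h t)\<^sup>2) has_real_derivative 0) (at t)" for t
    by (auto intro!: derivative_eq_intros h k simp: algebra_simps power2_eq_square)
  then have "(k t)\<^sup>2 + (\<omega> * h t)\<^sup>2 = (k 0)\<^sup>2 + (\<omega> * h 0)\<^sup>2" for t
    by (intro DERIV_isconst_all) blast
  then have "h t = 0" for t
    using assms(4) by (simp add: init sum_power2_eq_zero_iff)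
  then show ?thesis
    by (auto simp: h_def)
qed

section \<open>The constant \<open>alpha1\<close>\<close>

lemma alpha1_bounds:
  assumes "\<phi> > 1"
  shows "0 < alpha1 \<phi>" "alpha1 \<phi> < 1"
proof -
  define s where "s = sqrt (1 - (1 / \<phi>)\<^sup>2)"
  have "(1 / \<phi>)\<^sup>2 > 0" "(1 / \<phi>)\<^sup>2 < 1"
    using assms by (simp_all add: power2_eq_square field_simps less_1_mult)
  then have "0 < 1 - (1 / \<phi>)\<^sup>2" "1 - (1 / \<phi>)\<^sup>2 < 2"
    by linarith+
  then have s: "0 < s" "s < sqrt 2"
    unfolding s_def by (simp_all only: real_sqrt_gt_0_iff real_sqrt_less_iff)
  then show "0 < alpha1 \<phi>" "alpha1 \<phi> < 1"
    by (auto simp: alpha1_def s_def[symmetric] intro!: divide_pos_pos)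
qed

text \<open>Keeps the arguments of ln and the denominators positive: the expression is
  \<open>2 * alpha1 \<phi>\<close> plus a nonnegative multiple of
  \<open>1 + cos \<tau>\<close>.\<close>

lemma one_plus_alpha1_cos_pos:
  assumes "\<phi> > 1"
  shows "(1 + alpha1 \<phi>) + (1 - alpha1 \<phi>) * cos \<tau> > 0"
proof -
  have "(1 - alpha1 \<phi>) * (1 + cos \<tau>) \<ge> 0"
    using alpha1_bounds[OF assms] cos_ge_minus_one[of \<tau>] by (intro mult_nonneg_nonneg) linarith+
  then have "0 < 2 * alpha1 \<phi> + (1 - alpha1 \<phi>) * (1 + cos \<tau>)"
    using alpha1_bounds[OF assms] by simp
  also have "\<dots> = (1 + alpha1 \<phi>) + (1 - alpha1 \<phi>) * cos \<tau>"
    by (simp add: algebra_simps)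
  finally show ?thesis .
qed

text \<open>The right-hand sides are the mean m and the amplitude a of the oscillating function
  \<open>y\<close> of the main proof. Here \<open>alpha1 \<phi>\<close> is the ratio (m - a) / (m +
  a), and \<kappa> is the scale for which the shifted cosine equals \<kappa> times
  \<open>(1 + alpha1 \<phi>) + (1 - alpha1 \<phi>) * cos \<tau>\<close>.\<close>

lemma alpha1_identities:
  fixes \<phi> :: real
  assumes "\<phi> > 1"
  defines "\<omega> \<equiv> sqrt (\<phi>\<^sup>2 + 1)"
  defines "\<kappa> \<equiv> 1 / (2 * sqrt 2 * \<omega> * sqrt (alpha1 \<phi>))"
  shows "\<kappa> * (1 + alpha1 \<phi>) = \<phi> / \<omega>\<^sup>2"
    and "\<kappa> * (1 - alpha1 \<phi>) = sqrt ((\<phi>\<^sup>2 - 1) / 2) / \<omega>\<^sup>2"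
proof -
  define s where "s = sqrt (1 - (1 / \<phi>)\<^sup>2)"
  have lt: "1 < \<phi>\<^sup>2"
    using assms(1) by (simp add: power2_eq_square less_1_mult)
  have "(1 / \<phi>)\<^sup>2 \<le> 1"
    using lt by (simp add: power_divide divide_le_eq)
  then have s2: "s\<^sup>2 = 1 - (1 / \<phi>)\<^sup>2" and s0: "s \<ge> 0"
    unfolding s_def by simp_all
  have sp: "sqrt 2 + s > 0"
    using s0 by (simp add: add_pos_nonneg)
  have w: "\<omega> > 0"
    unfolding \<omega>_def by (simp add: add_nonneg_pos)
  have w2: "\<omega>\<^sup>2 = \<phi>\<^sup>2 + 1"
    by (simp add: \<omega>_def)
  have alpha: "alpha1 \<phi> = (sqrt 2 - s) / (sqrt 2 + s)"
    by (simp only: alpha1_def s_def)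
  \<comment> \<open>Extending the fraction by \<open>sqrt 2 + s\<close> turns its numerator into
    \<open>2 - s^2\<close>, which is a square, so that the root in \<kappa> can be
    extracted.\<close>
  have "alpha1 \<phi> = (\<omega> / (\<phi> * (sqrt 2 + s)))\<^sup>2"
  proof -
    have "alpha1 \<phi> = (sqrt 2 - s) * (sqrt 2 + s) / (sqrt 2 + s)\<^sup>2"
      using sp by (simp add: alpha power2_eq_square)
    also have "(sqrt 2 - s) * (sqrt 2 + s) = 2 - s\<^sup>2"
      by (simp add: power2_eq_square algebra_simps)
    also have "\<dots> = \<omega>\<^sup>2 / \<phi>\<^sup>2"
      using assms(1) by (simp add: s2 w2 field_simps)
    finally show ?thesis
      by (simp add: power_divide power_mult_distrib)
  qed
  then have "sqrt (alpha1 \<phi>) = \<omega> / (\<phi> * (sqrt 2 + s))"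
    using w sp assms(1) by simp
  then have k: "\<kappa> = \<phi> * (sqrt 2 + s) / (2 * sqrt 2 * \<omega>\<^sup>2)"
    unfolding \<kappa>_def using w sp assms(1) by (simp add: power2_eq_square)
  have "1 + alpha1 \<phi> = 2 * sqrt 2 / (sqrt 2 + s)" "1 - alpha1 \<phi> = 2 * s / (sqrt 2 + s)"
    using sp by (simp_all add: alpha field_simps)
  then have *: "\<kappa> * (1 + alpha1 \<phi>) = \<phi> / \<omega>\<^sup>2" "\<kappa> * (1 - alpha1 \<phi>) = \<phi> * s / sqrt 2 / \<omega>\<^sup>2"
    using sp w by (simp_all add: k)
  have "\<phi> * s = sqrt (\<phi>\<^sup>2 - 1)"
    using s0 assms(1) by (intro real_sqrt_unique[symmetric])
      (simp_all add: power_mult_distrib s2 field_simps)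
  with * show "\<kappa> * (1 + alpha1 \<phi>) = \<phi> / \<omega>\<^sup>2"
    "\<kappa> * (1 - alpha1 \<phi>) = sqrt ((\<phi>\<^sup>2 - 1) / 2) / \<omega>\<^sup>2"
    by (simp_all add: real_sqrt_divide)
qed

section \<open>Integration of the geodesic equations\<close>

lemma geodesic_coordinate_derivs:
  assumes "geodesic g \<gamma>"
  shows "((\<lambda>t. \<gamma> t $ k) has_real_derivative velocity \<gamma> t $ k) (at t)"
    and "((\<lambda>t. velocity \<gamma> t $ k) has_real_derivative velocity (velocity \<gamma>) t $ k) (at t)"
proof -
  have "(\<gamma> has_vector_derivative velocity \<gamma> t) (at t)"
    "(velocity \<gamma> has_vector_derivative velocity (velocity \<gamma>) t) (at t)"
    using assms by (auto simp: geodesic_def velocity_def[abs_def] vector_derivative_works)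
  then show "((\<lambda>t. \<gamma> t $ k) has_real_derivative velocity \<gamma> t $ k) (at t)"
    "((\<lambda>t. velocity \<gamma> t $ k) has_real_derivative velocity (velocity \<gamma>) t $ k) (at t)"
    by (auto simp: has_real_derivative_iff_has_vector_derivative
        dest: bounded_linear.has_vector_derivative[OF bounded_linear_vec_nth])
qed

lemma unit_geodesic_has_form:
  assumes geo: "geodesic ds0 \<gamma>"
    and unit: "\<And>t. ds0 (\<gamma> t) (velocity \<gamma> t) (velocity \<gamma> t) = 1"
    and init: "\<gamma> 0 = 0"
    and comp: "\<And>t. e0_component (\<gamma> t) (velocity \<gamma> t) = \<phi>"
    and \<phi>: "\<phi> > 1"
  shows "\<exists>t0. has_geodesic_form \<phi> t0 \<gamma>"
proof -
  define v where "v = velocity \<gamma>"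
  note dx = geodesic_coordinate_derivs(1)[OF geo, folded v_def]
  note dv = geodesic_coordinate_derivs(2)[OF geo, folded v_def]
  \<comment> \<open>The component of the velocity along the left-invariant field \<open>e2\<close>;
    the conserved component is then \<open>v t $ 0 + u t\<close>.\<close>
  define u where "u = (\<lambda>t. exp (\<gamma> t $ 1) * v t $ 2)"
  have v0: "v t $ 0 = \<phi> - u t" for t
    using comp[of t] by (simp add: e0_component_def u_def v_def)
  have v2: "v t $ 2 = u t / exp (\<gamma> t $ 1)" for t
    by (simp add: u_def)
  have energy: "(v t $ 1)\<^sup>2 + (u t)\<^sup>2 / 2 = \<phi>\<^sup>2 - 1" for t
  proof -
    have "(v t $ 0)\<^sup>2 + 2 * v t $ 0 * u t + (u t)\<^sup>2 / 2 - (v t $ 1)\<^sup>2 = 1"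
      using unit[of t] unfolding ds0_quadratic v_def[symmetric] u_def
      by (simp add: power_mult_distrib exp_double mult_ac)
    then show ?thesis
      unfolding v0 by (simp add: power2_eq_square algebra_simps)
  qed
  have acc0: "velocity v t $ 0 = - (v t $ 1 * (2 * \<phi> - u t))" for t
    using geodesic_ds0_equations(1)[OF geo, of t] unfolding v_def[symmetric] v0 v2
    by (simp add: algebra_simps)
  have acc1: "velocity v t $ 1 = - \<phi> * u t + (u t)\<^sup>2 / 2" for t
    using geodesic_ds0_equations(2)[OF geo, of t] unfolding v_def[symmetric] v0 v2
    by (simp add: algebra_simps power2_eq_square exp_double)
  \<comment> \<open>The energy relation gives \<open>u^2 \<le> 2 * \<phi>^2 - 2\<close>, below
    \<open>(2 * \<phi>)^2\<close>; this makes the reciprocal \<open>y\<close> well defined and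
    positive.\<close>
  have p_pos: "2 * \<phi> - u t > 0" for t
  proof -
    have "(u t)\<^sup>2 \<le> 2 * \<phi>\<^sup>2 - 2"
      using energy[of t] zero_le_power2[of "v t $ 1"] by linarith
    also have "\<dots> < 4 * \<phi>\<^sup>2"
      using zero_le_power2[of \<phi>] by linarith
    also have "\<dots> = (2 * \<phi>)\<^sup>2"
      by (simp add: power_mult_distrib)
    finally have "u t < 2 * \<phi>"
      by (rule power2_less_imp_less) (use \<phi> in simp)
    then show ?thesis by simp
  qed
  \<comment> \<open>By \<open>acc0\<close>, the derivative of \<open>\<phi> + v t $ 0\<close> is
    \<open>- v t $ 1\<close> times itself, so its reciprocal grows at the logarithmic rate
    \<open>v t $ 1\<close>, exactly as \<open>exp (\<gamma> t $ 1)\<close> does.\<close>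
  define y where "y = (\<lambda>t. 1 / (\<phi> + v t $ 0))"
  have p: "\<phi> + v t $ 0 = 2 * \<phi> - u t" for t
    by (simp add: v0)
  have y_pos: "y t > 0" for t
    using p_pos[of t] by (simp add: y_def p)
  have u: "u t = 2 * \<phi> - 1 / y t" for t
    using p[of t] by (simp add: y_def)
  have dy: "(y has_real_derivative v t $ 1 * y t) (at t)" for t
  proof -
    have "\<phi> + v t $ 0 \<noteq> 0" "velocity v t $ 0 = - (v t $ 1 * (\<phi> + v t $ 0))"
      using p_pos[of t] unfolding p acc0 by simp_all
    then show ?thesis
      unfolding y_def by (auto intro!: derivative_eq_intros dv)
  qed
  define \<omega> where "\<omega> = sqrt (\<phi>\<^sup>2 + 1)"
  have w2: "\<omega>\<^sup>2 = \<phi>\<^sup>2 + 1"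
    by (simp add: \<omega>_def)
  have w: "\<omega> > 0"
    unfolding \<omega>_def by (simp add: add_nonneg_pos)
  \<comment> \<open>The second derivative of \<open>y\<close> is \<open>(x1'' + x1'^2) * y\<close>.
    The terms quadratic in \<open>u\<close> cancel between \<open>acc1\<close> and
    \<open>energy\<close>, and \<open>u * y = 2 * \<phi> * y - 1\<close> makes the equation linear
    in \<open>y\<close>.\<close>
  have ddy: "((\<lambda>t. v t $ 1 * y t) has_real_derivative - (\<omega>\<^sup>2 * (y t - \<phi> / \<omega>\<^sup>2))) (at t)" for t
  proof -
    have "((\<lambda>t. v t $ 1 * y t) has_real_derivative
        (velocity v t $ 1 + (v t $ 1)\<^sup>2) * y t) (at t)"
      by (auto intro!: derivative_eq_intros dv dy simp: power2_eq_square algebra_simps)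
    also have "velocity v t $ 1 + (v t $ 1)\<^sup>2 = \<phi>\<^sup>2 - 1 - \<phi> * u t"
      using acc1[of t] energy[of t] by linarith
    also have "(\<phi>\<^sup>2 - 1 - \<phi> * u t) * y t = - (\<omega>\<^sup>2 * (y t - \<phi> / \<omega>\<^sup>2))"
    proof -
      have "\<omega>\<^sup>2 * (y t - \<phi> / \<omega>\<^sup>2) = \<omega>\<^sup>2 * y t - \<phi>"
        using w by (simp add: right_diff_distrib)
      then show ?thesis
        unfolding u w2 using y_pos[of t] by (simp add: field_simps power2_eq_square)
    qed
    finally show ?thesis .
  qed
  define A where "A = sqrt ((\<phi>\<^sup>2 - 1) / 2) / \<omega>\<^sup>2"
  have lt: "1 < \<phi>\<^sup>2"
    using \<phi> by (simp add: power2_eq_square less_1_mult)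
  have A: "A > 0"
    unfolding A_def using lt w by simp
  have A2: "(\<omega> * A)\<^sup>2 = (\<phi>\<^sup>2 - 1) / (2 * \<omega>\<^sup>2)"
    unfolding A_def using lt w by (simp add: power_mult_distrib power_divide field_simps)
  \<comment> \<open>Time 0 suffices, since the oscillator conserves its energy. The terms in
    \<open>y 0\<close> cancel between the two squares, so the amplitude depends on \<phi>
    alone.\<close>
  have amplitude: "(\<omega> * (y 0 - \<phi> / \<omega>\<^sup>2))\<^sup>2 + (v 0 $ 1 * y 0)\<^sup>2 = (\<omega> * A)\<^sup>2"
  proof -
    have "(v 0 $ 1)\<^sup>2 = \<phi>\<^sup>2 - 1 - (2 * \<phi> - 1 / y 0)\<^sup>2 / 2"
      using energy[of 0] unfolding u by linarith
    then have "(v 0 $ 1 * y 0)\<^sup>2 = (\<phi>\<^sup>2 - 1) * (y 0)\<^sup>2 - (2 * \<phi> * y 0 - 1)\<^sup>2 / 2"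
      using y_pos[of 0] by (simp add: power_mult_distrib field_simps power2_eq_square)
    also have "\<dots> = - (\<omega>\<^sup>2 * (y 0)\<^sup>2) + 2 * \<phi> * y 0 - 1 / 2"
      unfolding w2 by (simp add: field_simps power2_eq_square)
    finally have 1: "(v 0 $ 1 * y 0)\<^sup>2 = - (\<omega>\<^sup>2 * (y 0)\<^sup>2) + 2 * \<phi> * y 0 - 1 / 2" .
    have 2: "(\<omega> * (y 0 - \<phi> / \<omega>\<^sup>2))\<^sup>2 = \<omega>\<^sup>2 * (y 0)\<^sup>2 - 2 * \<phi> * y 0 + \<phi>\<^sup>2 / \<omega>\<^sup>2"
      using w by (simp add: field_simps power2_eq_square)
    have 3: "\<phi>\<^sup>2 / \<omega>\<^sup>2 - 1 / 2 = (\<phi>\<^sup>2 - 1) / (2 * \<omega>\<^sup>2)"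
      using w by (simp add: field_simps) (simp add: w2)
    show ?thesis
      unfolding 1 2 A2 3[symmetric] by simp
  qed
  have "((\<lambda>t. y t - \<phi> / \<omega>\<^sup>2) has_real_derivative v t $ 1 * y t) (at t)" for t
    using dy[of t] by (auto intro!: derivative_eq_intros)
  from harmonic_oscillator[OF this ddy amplitude w A]
  obtain t0 where t0: "\<And>t. y t - \<phi> / \<omega>\<^sup>2 = A * cos (\<omega> * (t - t0))"
    by blast
  define \<alpha> where "\<alpha> = alpha1 \<phi>"
  define D where "D = (\<lambda>\<tau>. (1 + \<alpha>) + (1 - \<alpha>) * cos \<tau>)"
  define T where "T = (\<lambda>t. \<omega> * (t - t0))"
  define \<kappa> where "\<kappa> = 1 / (2 * sqrt 2 * \<omega> * sqrt \<alpha>)"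
  have \<alpha>: "0 < \<alpha>" "\<alpha> < 1"
    unfolding \<alpha>_def using alpha1_bounds[OF \<phi>] by auto
  have k: "\<kappa> > 0"
    unfolding \<kappa>_def using w \<alpha> by simp
  have kid: "\<kappa> * (1 + \<alpha>) = \<phi> / \<omega>\<^sup>2" "\<kappa> * (1 - \<alpha>) = A"
    using alpha1_identities[OF \<phi>] unfolding \<kappa>_def \<omega>_def \<alpha>_def A_def by simp_all
  have Dpos: "D \<tau> > 0" for \<tau>
    unfolding D_def \<alpha>_def by (rule one_plus_alpha1_cos_pos[OF \<phi>])
  have y_expand: "y t = \<phi> / \<omega>\<^sup>2 + A * cos (T t)" for t
    using t0[of t] by (simp add: T_def)
  have y: "y t = \<kappa> * D (T t)" for t
    unfolding y_expand D_def kid[symmetric] by (simp add: algebra_simps)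
  have T0: "T 0 = - \<omega> * t0"
    by (simp add: T_def)
  have dT: "(T has_real_derivative \<omega>) (at t)" for t
    unfolding T_def by (auto intro!: derivative_eq_intros)
  \<comment> \<open>Both functions have logarithmic derivative \<open>v t $ 1\<close>, so their
    quotient is constant; the initial point makes it \<open>1 / y 0\<close>.\<close>
  have exp_x1: "exp (\<gamma> t $ 1) = y t / y 0" for t
  proof -
    have "((\<lambda>t. exp (\<gamma> t $ 1) / y t) has_real_derivative 0) (at t)" for t
      using y_pos[of t]
      by (auto intro!: derivative_eq_intros dx dy)
    then have "exp (\<gamma> t $ 1) / y t = exp (\<gamma> 0 $ 1) / y 0"
      by (intro DERIV_isconst_all) blast
    then show ?thesis
      using y_pos[of t] y_pos[of 0] by (simp add: init field_simps)
  qed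
  have x1: "\<gamma> t $ 1 = ln (D (T t)) - ln (D (T 0))" for t
  proof -
    have "exp (\<gamma> t $ 1) = D (T t) / D (T 0)"
      unfolding exp_x1 y using k by simp
    then have "\<gamma> t $ 1 = ln (D (T t) / D (T 0))"
      by (metis ln_exp)
    then show ?thesis
      using Dpos[of "T t"] Dpos[of "T 0"] by (simp add: ln_div)
  qed
  \<comment> \<open>By the half-angle formula, the denominator in \<open>DERIV_arctan_tan\<close> at
    \<open>T t / 2\<close> is \<open>D (T t) / 2\<close>. The factor \<open>2 * sqrt 2\<close> is
    the one that turns the result into \<open>1 / (\<kappa> * D (T t))\<close>.\<close>
  have dF: "((\<lambda>t. 2 * sqrt 2 * arctan_tan (sqrt \<alpha>) (T t / 2)) has_real_derivative 1 / y t) (at t)"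
    for t
  proof -
    have "((\<lambda>t. arctan_tan (sqrt \<alpha>) (T t / 2)) has_real_derivative
        sqrt \<alpha> / ((cos (T t / 2))\<^sup>2 + (sqrt \<alpha>)\<^sup>2 * (sin (T t / 2))\<^sup>2) * (\<omega> / 2)) (at t)"
      by (rule DERIV_chain2[OF DERIV_arctan_tan]) (use \<alpha> in \<open>auto intro!: derivative_eq_intros dT\<close>)
    also have "(cos (T t / 2))\<^sup>2 + (sqrt \<alpha>)\<^sup>2 * (sin (T t / 2))\<^sup>2 = D (T t) / 2"
    proof -
      have "(cos (T t / 2))\<^sup>2 = (1 + cos (T t)) / 2"
        using cos_double_cos[of "T t / 2"] by simp
      then show ?thesis
        using \<alpha> unfolding D_def sin_squared_eq by (simp add: field_simps)
    qed
    finally have "((\<lambda>t. 2 * sqrt 2 * arctan_tan (sqrt \<alpha>) (T t / 2)) has_real_derivative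
        2 * sqrt 2 * (sqrt \<alpha> / (D (T t) / 2) * (\<omega> / 2))) (at t)"
      by (rule DERIV_cmult)
    also have "2 * sqrt 2 * (sqrt \<alpha> / (D (T t) / 2) * (\<omega> / 2)) = 1 / y t"
      unfolding y \<kappa>_def by simp
    finally show ?thesis .
  qed
  \<comment> \<open>Both sides have derivative \<open>1 / y t - \<phi>\<close>; the subtracted
    bracket is the value of the preceding terms at time 0, so both sides start at 0.\<close>
  have x0: "\<gamma> t $ 0 = - \<phi> * (t - t0) + 2 * sqrt 2 * arctan_tan (sqrt \<alpha>) (T t / 2)
      - (\<phi> * t0 + 2 * sqrt 2 * arctan_tan (sqrt \<alpha>) (T 0 / 2))" for t
  proof (rule DERIV_eq_imp_eq[where a = 0 and h = "\<lambda>t. 1 / y t - \<phi>"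
        and f = "\<lambda>t. \<gamma> t $ 0" and t = t
        and g = "\<lambda>t. - \<phi> * (t - t0) + 2 * sqrt 2 * arctan_tan (sqrt \<alpha>) (T t / 2)
          - (\<phi> * t0 + 2 * sqrt 2 * arctan_tan (sqrt \<alpha>) (T 0 / 2))"])
    show "((\<lambda>t. \<gamma> t $ 0) has_real_derivative 1 / y t - \<phi>) (at t)" for t
      using dx[of 0 t] unfolding v0 u by (simp add: algebra_simps)
    define F where "F = (\<lambda>t. 2 * sqrt 2 * arctan_tan (sqrt \<alpha>) (T t / 2))"
    have "(F has_real_derivative 1 / y t) (at t)" for t
      unfolding F_def by (rule dF)
    then have "((\<lambda>t. - \<phi> * (t - t0) + F t - (\<phi> * t0 + F 0)) has_real_derivative
        1 / y t - \<phi>) (at t)" for t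
      by (auto intro!: derivative_eq_intros)
    then show "((\<lambda>t. - \<phi> * (t - t0) + 2 * sqrt 2 * arctan_tan (sqrt \<alpha>) (T t / 2)
        - (\<phi> * t0 + 2 * sqrt 2 * arctan_tan (sqrt \<alpha>) (T 0 / 2))) has_real_derivative
        1 / y t - \<phi>) (at t)" for t
      unfolding F_def .
  qed (simp add: init)
  define b where "b = beta1 \<phi> t0"
  \<comment> \<open>The factor \<open>D (T 0)\<close> supplies the \<open>y 0\<close> that enters
    \<open>x2'\<close> through \<open>exp_x1\<close>; evenness of cos absorbs the sign in
    \<open>T 0 = - \<omega> * t0\<close>.\<close>
  have b: "b = 2 * \<omega> * A * D (T 0)"
  proof -
    have "sqrt (2 * (\<phi>\<^sup>2 - 1)) = 2 * sqrt ((\<phi>\<^sup>2 - 1) / 2)"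
      by (rule real_sqrt_unique) (use lt in \<open>simp_all add: power_mult_distrib\<close>)
    then have "sqrt (2 * (\<phi>\<^sup>2 - 1)) / \<omega> = 2 * \<omega> * A"
      unfolding A_def using w by (simp add: power2_eq_square)
    moreover have "b = sqrt (2 * (\<phi>\<^sup>2 - 1)) / \<omega> * D (T 0)"
      by (simp add: b_def beta1_def D_def \<alpha>_def T0 \<omega>_def)
    ultimately show ?thesis by simp
  qed
  have dG: "((\<lambda>t. b * sin (T t) / D (T t)) has_real_derivative
      y 0 * (2 * \<phi> * y t - 1) / (y t)\<^sup>2) (at t)" for t
  proof -
    define c where "c = cos (T t)"
    \<comment> \<open>\<open>N\<close> is what remains of the numerator in the quotient rule after
      replacing sin^2 by 1 - cos^2: it is \<open>D\<close> with its two coefficients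
      exchanged.\<close>
    define N where "N = (1 + \<alpha>) * c + (1 - \<alpha>)"
    have sq: "sin (T t) * sin (T t) = 1 - c * c"
      using sin_squared_eq[of "T t"] by (simp add: c_def power2_eq_square)
    have Dt: "D (T t) = (1 + \<alpha>) + (1 - \<alpha>) * c"
      by (simp add: D_def c_def)
    have dD: "((\<lambda>t. D (T t)) has_real_derivative - ((1 - \<alpha>) * sin (T t) * \<omega>)) (at t)"
      unfolding D_def by (auto intro!: derivative_eq_intros dT)
    have dS: "((\<lambda>t. b * sin (T t)) has_real_derivative b * c * \<omega>) (at t)"
      unfolding c_def by (auto intro!: derivative_eq_intros dT)
    have "b * c * \<omega> * D (T t) - b * sin (T t) * - ((1 - \<alpha>) * sin (T t) * \<omega>)
        = b * \<omega> * (c * D (T t) + (1 - \<alpha>) * (sin (T t) * sin (T t)))"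
      by (simp add: algebra_simps)
    also have "\<dots> = b * \<omega> * N"
      unfolding sq Dt N_def by (simp add: algebra_simps)
    finally have num: "b * c * \<omega> * D (T t) - b * sin (T t) * - ((1 - \<alpha>) * sin (T t) * \<omega>) = b * \<omega> * N" .
    have "((\<lambda>t. b * sin (T t) / D (T t)) has_real_derivative b * \<omega> * N / (D (T t) * D (T t))) (at t)"
      using DERIV_divide[OF dS dD] Dpos[of "T t"] unfolding num by simp
    also have "b * \<omega> * N / (D (T t) * D (T t)) = y 0 * (2 * \<phi> * y t - 1) / (y t)\<^sup>2"
    proof -
      have "2 * \<phi> * y t - 1 = (\<phi>\<^sup>2 - 1) / \<omega>\<^sup>2 + 2 * \<phi> * A * c"
        unfolding y_expand c_def[symmetric] using w
        by (simp add: field_simps) (use w2 in \<open>simp add: power2_eq_square algebra_simps\<close>)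
      \<comment> \<open>\<open>A2\<close> replaces \<open>(\<phi>^2 - 1) / \<omega>^2\<close> by
        \<open>2 * \<omega>^2 * A^2\<close>, after which mean and amplitude appear in exchanged
        roles, matching \<open>\<kappa> * N\<close>.\<close>
      also have "\<dots> = 2 * \<omega>\<^sup>2 * A * (A + \<phi> / \<omega>\<^sup>2 * c)"
        using A2 w by (simp add: field_simps power2_eq_square)
      also have "\<dots> = 2 * \<omega>\<^sup>2 * A * (\<kappa> * N)"
        unfolding kid[symmetric] N_def by (simp add: algebra_simps)
      finally have "2 * \<phi> * y t - 1 = 2 * \<omega>\<^sup>2 * A * (\<kappa> * N)" .
      then show ?thesis
        unfolding y b using k Dpos[of "T t"] by (simp add: field_simps power2_eq_square)
    qed
    finally show ?thesis .
  qed
  have x2: "\<gamma> t $ 2 = b * sin (T t) / D (T t) - b * sin (T 0) / D (T 0)" for t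
  proof (rule DERIV_eq_imp_eq[where a = 0 and f = "\<lambda>t. \<gamma> t $ 2" and t = t
        and g = "\<lambda>t. b * sin (T t) / D (T t) - b * sin (T 0) / D (T 0)"
        and h = "\<lambda>t. y 0 * (2 * \<phi> * y t - 1) / (y t)\<^sup>2"])
    show "((\<lambda>t. \<gamma> t $ 2) has_real_derivative y 0 * (2 * \<phi> * y t - 1) / (y t)\<^sup>2) (at t)" for t
    proof -
      have "v t $ 2 = y 0 * (2 * \<phi> * y t - 1) / (y t)\<^sup>2"
        unfolding v2 exp_x1 u using y_pos[of t] y_pos[of 0]
        by (simp add: field_simps power2_eq_square)
      then show ?thesis using dx[of 2 t] by simp
    qed
    show "((\<lambda>t. b * sin (T t) / D (T t) - b * sin (T 0) / D (T 0)) has_real_derivative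
        y 0 * (2 * \<phi> * y t - 1) / (y t)\<^sup>2) (at t)" for t
      using DERIV_diff[OF dG DERIV_const] by simp
  qed (simp add: init)
  have "has_geodesic_form \<phi> t0 \<gamma>"
    unfolding has_geodesic_form_def eval_between_def
    using x0 x1 x2 unfolding T0 unfolding T_def D_def \<omega>_def \<alpha>_def b_def by blast
  then show ?thesis by blast
qed

section \<open>The general form and the case \<open>t0 = 0\<close>\<close>

theorem theorem2:
  fixes \<gamma> :: "real \<Rightarrow> real ^ 3" and \<phi>0 :: real
  assumes "geodesic ds0 \<gamma>"
    and "timelike_curve ds0 \<gamma>"
    and "future_directed \<gamma>"
    and "\<forall>t. ds0 (\<gamma> t) (velocity \<gamma> t) (velocity \<gamma> t) = 1"
    and "\<gamma> 0 = 0"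
    and "\<forall>t. e0_component (\<gamma> t) (velocity \<gamma> t) = \<phi>0"
    and "\<phi>0 > 1"
  shows "(\<exists>t0. has_geodesic_form \<phi>0 t0 \<gamma>) \<and>
    (\<forall>t0. has_geodesic_form \<phi>0 t0 \<gamma> \<and> velocity \<gamma> 0 $ 1 = 0 \<and> t0 = 0 \<longrightarrow>
      (\<forall>t. \<gamma> t $ 0 = - \<phi>0 * t
              + 2 * sqrt 2 * arctan_tan (sqrt (alpha1 \<phi>0)) (sqrt (\<phi>0\<^sup>2 + 1) * t / 2) \<and>
           \<gamma> t $ 1 = ln (((1 + alpha1 \<phi>0) + (1 - alpha1 \<phi>0) * cos (sqrt (\<phi>0\<^sup>2 + 1) * t)) / 2) \<and>
           \<gamma> t $ 2 = 2 * sqrt (2 * (\<phi>0\<^sup>2 - 1)) / sqrt (\<phi>0\<^sup>2 + 1) *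
              (sin (sqrt (\<phi>0\<^sup>2 + 1) * t)
                / ((1 + alpha1 \<phi>0) + (1 - alpha1 \<phi>0) * cos (sqrt (\<phi>0\<^sup>2 + 1) * t)))))"
proof (intro conjI allI impI)
  show "\<exists>t0. has_geodesic_form \<phi>0 t0 \<gamma>"
    using assms by (intro unit_geodesic_has_form) auto
next
  fix t0 t
  assume "has_geodesic_form \<phi>0 t0 \<gamma> \<and> velocity \<gamma> 0 $ 1 = 0 \<and> t0 = 0"
  then have "has_geodesic_form \<phi>0 0 \<gamma>" by auto
  note form = this[unfolded has_geodesic_form_def eval_between_def, rule_format, of t]
  \<comment> \<open>For \<open>t0 = 0\<close> the lower limits are at \<tau> = 0. There the branch
    and the sine vanish, and (1 + \<alpha>) + (1 - \<alpha>) = 2, with \<alpha> the constant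
    \<open>alpha1 \<phi>0\<close>, yields the division by 2 inside ln and the factor 2 in the last
    coordinate.\<close>
  have "arctan_tan \<beta> 0 = 0" for \<beta>
    using arctan_tan_branch[of 0 0 \<beta>] by simp
  then show "\<gamma> t $ 0 = - \<phi>0 * t
      + 2 * sqrt 2 * arctan_tan (sqrt (alpha1 \<phi>0)) (sqrt (\<phi>0\<^sup>2 + 1) * t / 2)"
    using form by simp
  show "\<gamma> t $ 1 = ln (((1 + alpha1 \<phi>0) + (1 - alpha1 \<phi>0) * cos (sqrt (\<phi>0\<^sup>2 + 1) * t)) / 2)"
    using form one_plus_alpha1_cos_pos[OF assms(7), of "sqrt (\<phi>0\<^sup>2 + 1) * t"] by (simp add: ln_div)
  show "\<gamma> t $ 2 = 2 * sqrt (2 * (\<phi>0\<^sup>2 - 1)) / sqrt (\<phi>0\<^sup>2 + 1) *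
      (sin (sqrt (\<phi>0\<^sup>2 + 1) * t)
        / ((1 + alpha1 \<phi>0) + (1 - alpha1 \<phi>0) * cos (sqrt (\<phi>0\<^sup>2 + 1) * t)))"
    using form by (simp add: beta1_def)
qed

end
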